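(* Let $\mathcal{A}:\mathbb{R}^{m\times n}\to\mathbb{R}^p$ be a linear map and suppose that $b=\mathcal{A}X_r+e$, where $X_r\in\mathbb{R}^{m\times n}$ is a rank-$r$ matrix and $e\in\mathbb{R}^p$. Suppose $\mathcal{A}$ has the restricted isometry property with $\delta_{3r}(\mathcal{A})\le \alpha/\sqrt{8}$, where $\alpha\in(0,1)$. Let $X^0,X^1,X^2,\ldots$ be the iterates produced by the algorithm IHT (Iterative Hard Thresholding, defined in the context) with data $\mathcal{A},b,r$ and given initial matrix $X^0\in\mathbb{R}^{m\times n}$. Then, at iteration $k$, IHT will recover an approximation $X^k$ satisfying $$\|X_r-X^k\|_F\le \alpha^k\|X_r-X^0\|_F+\frac{\beta}{1-\alpha}\|e\|_2,$$ where $\beta:=2\sqrt{1+\alpha/\sqrt{8}}$. Furthermore, after at most $$k^*:=\left\lceil\log_{1/\alpha}\left(\|X_r-X^0\|_F/\|e\|_2\right)\right\rceil$$ iterations, IHT estimates $X_r$ with accuracy $$\|X_r-X^{k^*}\|_F\le \frac{1-\alpha+\beta}{1-\alpha}\|e\|_2 .$$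
   Context: Throughout $m\le n$. $\|\cdot\|_F$ is the Frobenius norm on $\mathbb{R}^{m\times n}$ (with inner product $\langle X,Y\rangle=\mathrm{Tr}(X^\top Y)$), $\|\cdot\|_2$ is the Euclidean norm on $\mathbb{R}^p$, and $\mathcal{A}^*:\mathbb{R}^p\to\mathbb{R}^{m\times n}$ is the adjoint of $\mathcal{A}$. $\mathcal{A}X$ means $\mathcal{A}(X)$. Restricted isometry constant: for an integer $s$ with $1\le s\le m$, $\delta_s(\mathcal{A})$ is the minimum constant such that $(1-\delta_s(\mathcal{A}))\|X\|_F^2\le\|\mathcal{A}X\|_2^2\le(1+\delta_s(\mathcal{A}))\|X\|_F^2$ for all $X\in\mathbb{R}^{m\times n}$ with $\mathrm{rank}(X)\le s$. Best rank-$r$ approximation (hard thresholding): if $X=\sum_{i=1}^m\sigma_iu_iv_i^\top$ is the singular value decomposition of $X$ with $\sigma_1\ge\cdots\ge\sigma_m$, then $R_r(X)=\sum_{i=1}^r\sigma_iu_iv_i^\top$. Algorithm IHT: given $X^0$ and $r$, for $k=0,1,2,\ldots$ set $Y^{k+1}:=X^k-\mathcal{A}^*(\mathcal{A}X^k-b)$ and $X^{k+1}:=R_r(Y^{k+1})$.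
   Formalization: The initial matrix X^0 is assumed to have rank at most r, since the bound fails for arbitrary X^0 (δ_{3r} does not control X_r − X^0); the second claim assumes e ≠ 0, and a negative k* is read as 0 iterations. *)

theory Defs
  imports "HOL-Analysis.Analysis"
begin

text \<open>
  Matrices with m rows and n columns have type \<open>real^'n^'m\<close>. The library inner product and norm
  on this type are the trace inner product and the Frobenius norm, so the library \<open>adjoint\<close> is
  the adjoint with respect to the trace inner product.
\<close>

lemma inner_matrix_eq_trace:
  fixes X Y :: "real^'n^'m"
  shows "X \<bullet> Y = trace (transpose X ** Y)"
  by (simp add: inner_vec_def trace_def transpose_def matrix_matrix_mult_def)
     (rule sum.swap)

lemma norm_matrix_eq_frobenius:
  fixes X :: "real^'n^'m"
  shows "norm X = sqrt (\<Sum>i\<in>UNIV. \<Sum>j\<in>UNIV. (X $ i $ j)\<^sup>2)"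
  by (simp add: norm_eq_sqrt_inner inner_vec_def power2_eq_square)

definition rip_bound :: "(real^'n^'m \<Rightarrow> real^'p) \<Rightarrow> nat \<Rightarrow> real \<Rightarrow> bool" where
  "rip_bound A s d \<longleftrightarrow>
     (\<forall>X. rank X \<le> s \<longrightarrow>
        (1 - d) * (norm X)\<^sup>2 \<le> (norm (A X))\<^sup>2 \<and> (norm (A X))\<^sup>2 \<le> (1 + d) * (norm X)\<^sup>2)"

text \<open>
  Meaningful for \<open>s \<ge> 1\<close> only: for \<open>s = 0\<close> every real number satisfies \<open>rip_bound\<close> and there is
  no minimum. For linear \<open>A\<close> and \<open>s \<ge> 1\<close> the minimum exists, see \<open>rip_bound_rip_const\<close>.
\<close>
definition rip_const :: "(real^'n^'m \<Rightarrow> real^'p) \<Rightarrow> nat \<Rightarrow> real" where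
  "rip_const A s = (LEAST d. rip_bound A s d)"

definition outer :: "real^'m \<Rightarrow> real^'n \<Rightarrow> real^'n^'m" where
  "outer u v = (columnvector u :: real^1^'m) ** (rowvector v :: real^'n^1)"

text \<open>
  The singular triples are indexed by the natural numbers from 1 to m, in order of decreasing
  singular value. This is the thin decomposition, for m at most n.
\<close>
definition is_svd ::
  "(nat \<Rightarrow> real) \<Rightarrow> (nat \<Rightarrow> real^'m) \<Rightarrow> (nat \<Rightarrow> real^'n) \<Rightarrow> real^'n^'m \<Rightarrow> bool" where
  "is_svd \<sigma> u v X \<longleftrightarrow>
     (\<forall>i\<in>{1..CARD('m)}. 0 \<le> \<sigma> i) \<and>
     (\<forall>i\<in>{1..CARD('m)}. \<forall>j\<in>{1..CARD('m)}. i \<le> j \<longrightarrow> \<sigma> j \<le> \<sigma> i) \<and>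
     (\<forall>i\<in>{1..CARD('m)}. \<forall>j\<in>{1..CARD('m)}. u i \<bullet> u j = (if i = j then 1 else 0)) \<and>
     (\<forall>i\<in>{1..CARD('m)}. \<forall>j\<in>{1..CARD('m)}. v i \<bullet> v j = (if i = j then 1 else 0)) \<and>
     X = (\<Sum>i=1..CARD('m). \<sigma> i *\<^sub>R outer (u i) (v i))"

text \<open>
  If the r-th and the next singular value coincide, the truncation \<open>R\<^sub>r(X)\<close> depends on the chosen
  decomposition. It is therefore a relation: \<open>is_hard_threshold r X Z\<close> holds if \<open>Z\<close> is \<open>R\<^sub>r(X)\<close> for
  some singular value decomposition of \<open>X\<close>, and the iteration below allows every choice in every
  step.
\<close>
definition is_hard_threshold :: "nat \<Rightarrow> real^'n^'m \<Rightarrow> real^'n^'m \<Rightarrow> bool" where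
  "is_hard_threshold r X Z \<longleftrightarrow>
     (\<exists>\<sigma> u v. is_svd \<sigma> u v X \<and> Z = (\<Sum>i=1..r. \<sigma> i *\<^sub>R outer (u i) (v i)))"

definition iht_iterates ::
  "(real^'n^'m \<Rightarrow> real^'p) \<Rightarrow> real^'p \<Rightarrow> nat \<Rightarrow> real^'n^'m \<Rightarrow> (nat \<Rightarrow> real^'n^'m) \<Rightarrow> bool" where
  "iht_iterates A b r X0 X \<longleftrightarrow>
     X 0 = X0 \<and>
     (\<forall>k. is_hard_threshold r (X k - adjoint A (A (X k) - b)) (X (Suc k)))"

lemma ex_rank_1_matrix: "\<exists>X :: real^'n^'m. X \<noteq> 0 \<and> rank X \<le> 1"
proof -
  let ?X = "(\<chi> i j. 1) :: real^'n^'m"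
  have "rows ?X \<subseteq> {\<chi> j. 1}"
    by (auto simp: rows_def row_def)
  then have "dim (rows ?X) \<le> card {(\<chi> j. 1) :: real^'n}"
    by (intro dim_le_card) (auto intro: span_base)
  then have "rank ?X \<le> 1"
    by (simp add: row_rank_def)
  moreover have "?X \<noteq> 0"
    by (simp add: vec_eq_iff)
  ultimately show ?thesis by blast
qed

lemma rip_bound_rip_const:
  fixes A :: "real^'n^'m \<Rightarrow> real^'p"
  assumes "linear A" "1 \<le> s"
  shows "rip_bound A s (rip_const A s)"
    and "rip_bound A s d \<Longrightarrow> rip_const A s \<le> d"
proof -
  let ?S = "{d. rip_bound A s d}"
  obtain K where K: "0 < K" "\<And>X. norm (A X) \<le> K * norm X"
    using linear_bounded_pos[OF assms(1)] by blast
  have "rip_bound A s (1 + K\<^sup>2)"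
    unfolding rip_bound_def
  proof (intro allI impI conjI)
    fix X :: "real^'n^'m"
    have "(1 - (1 + K\<^sup>2)) * (norm X)\<^sup>2 \<le> 0"
      by simp
    also have "0 \<le> (norm (A X))\<^sup>2" by simp
    finally show "(1 - (1 + K\<^sup>2)) * (norm X)\<^sup>2 \<le> (norm (A X))\<^sup>2" .
    have "(norm (A X))\<^sup>2 \<le> (K * norm X)\<^sup>2"
      by (intro power_mono K) simp
    also have "\<dots> = K\<^sup>2 * (norm X)\<^sup>2"
      by (simp add: power_mult_distrib)
    also have "\<dots> \<le> (1 + (1 + K\<^sup>2)) * (norm X)\<^sup>2"
      by (intro mult_right_mono) auto
    finally show "(norm (A X))\<^sup>2 \<le> (1 + (1 + K\<^sup>2)) * (norm X)\<^sup>2" .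
  qed
  then have ne: "?S \<noteq> {}" by blast
  obtain X1 :: "real^'n^'m" where X1: "X1 \<noteq> 0" "rank X1 \<le> s"
    using ex_rank_1_matrix order_trans[OF _ assms(2)] by blast
  have "0 \<le> d" if "d \<in> ?S" for d
  proof -
    have "(1 - d) * (norm X1)\<^sup>2 \<le> (norm (A X1))\<^sup>2"
      and "(norm (A X1))\<^sup>2 \<le> (1 + d) * (norm X1)\<^sup>2"
      using that X1(2) unfolding rip_bound_def by blast+
    then have "(1 - d) * (norm X1)\<^sup>2 \<le> (1 + d) * (norm X1)\<^sup>2"
      by linarith
    moreover have "0 < (norm X1)\<^sup>2"
      using X1(1) by simp
    ultimately have "1 - d \<le> 1 + d"
      by (rule mult_right_le_imp_le)
    then show ?thesis by linarith
  qed
  then have bdd: "bdd_below ?S"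
    by (rule bdd_belowI)
  have "?S = (\<Inter>X\<in>{X. rank X \<le> s}.
      {d. (1 - d) * (norm X)\<^sup>2 \<le> (norm (A X))\<^sup>2} \<inter> {d. (norm (A X))\<^sup>2 \<le> (1 + d) * (norm X)\<^sup>2})"
    by (auto simp: rip_bound_def)
  also have "closed \<dots>"
    by (rule closed_INT, rule ballI, rule closed_Int; rule closed_Collect_le; intro continuous_intros)
  finally have "Inf ?S \<in> ?S"
    using closed_contains_Inf[OF ne bdd] by blast
  moreover have low: "Inf ?S \<le> d" if "rip_bound A s d" for d
    using that bdd by (intro cInf_lower) auto
  ultimately have eq: "rip_const A s = Inf ?S"
    unfolding rip_const_def by (intro Least_equality) simp_all
  show "rip_bound A s (rip_const A s)"
    using \<open>Inf ?S \<in> ?S\<close> eq by simp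
  show "rip_bound A s d \<Longrightarrow> rip_const A s \<le> d"
    using low eq by simp
qed

end

theory Submission
  imports Defs
begin

text \<open>
  By the Eckart--Young theorem, \<open>Z = R\<^sub>r(Y)\<close> is at least as close to \<open>Y\<close> as \<open>X\<^sub>r\<close> is. Expanding
  squares, \<open>D = X\<^sub>r - Z\<close> satisfies \<open>\<parallel>D\<parallel>\<^sup>2 \<le> 2 \<langle>D, X\<^sub>r - Y\<rangle>\<close>. With \<open>H = X\<^sub>r - X\<^sup>k\<close> the right-hand side
  is \<open>2 (\<langle>D, H\<rangle> - \<langle>A D, A H\<rangle> - \<langle>A D, e\<rangle>)\<close>. All linear combinations of \<open>D\<close> and \<open>H\<close> have rank at
  most \<open>3 r\<close>, so polarizing the restricted isometry property gives
  \<open>\<parallel>D\<parallel> \<le> 2 \<delta> \<parallel>H\<parallel> + 2 sqrt (1 + \<delta>) \<parallel>e\<parallel>\<close>. Since \<open>2 / sqrt 8 \<le> 1\<close>, this is a contraction with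
  factor \<open>\<alpha>\<close> up to the error term.
\<close>

section \<open>Orthonormal families\<close>

text \<open>Indexed families instead of sets: the lemma serves the vectors \<open>u i\<close>, the
  matrices \<open>outer (u i) (v i)\<close> and, with the identity as family, an orthonormal
  set.\<close>

lemma norm_sum_orthonormal:
  fixes f :: "'i \<Rightarrow> 'a::real_inner"
  assumes "finite I"
    and "\<And>i j. i \<in> I \<Longrightarrow> j \<in> I \<Longrightarrow> f i \<bullet> f j = (if i = j then 1 else 0)"
  shows "(norm (\<Sum>i\<in>I. a i *\<^sub>R f i))\<^sup>2 = (\<Sum>i\<in>I. (a i)\<^sup>2)"
proof -
  have "(norm (\<Sum>i\<in>I. a i *\<^sub>R f i))\<^sup>2 = (\<Sum>i\<in>I. \<Sum>j\<in>I. a i * (a j * (f i \<bullet> f j)))"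
    by (simp add: power2_norm_eq_inner inner_sum_left inner_sum_right sum_distrib_left
        inner_commute mult.left_commute)
  also have "\<dots> = (\<Sum>i\<in>I. \<Sum>j\<in>I. if i = j then (a i)\<^sup>2 else 0)"
    by (intro sum.cong refl) (simp add: assms(2) power2_eq_square)
  also have "\<dots> = (\<Sum>i\<in>I. (a i)\<^sup>2)"
    by (intro sum.cong refl) (simp add: assms(1))
  finally show ?thesis .
qed

lemma bessel_inequality:
  fixes f :: "'i \<Rightarrow> 'a::real_inner"
  assumes "finite I"
    and "\<And>i j. i \<in> I \<Longrightarrow> j \<in> I \<Longrightarrow> f i \<bullet> f j = (if i = j then 1 else 0)"
  shows "(\<Sum>i\<in>I. (f i \<bullet> w)\<^sup>2) \<le> (norm w)\<^sup>2"
proof -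
  let ?p = "\<Sum>i\<in>I. (f i \<bullet> w) *\<^sub>R f i"
  have "w \<bullet> ?p = (\<Sum>i\<in>I. (f i \<bullet> w)\<^sup>2)"
    by (simp add: inner_sum_right power2_eq_square inner_commute)
  moreover have "(norm ?p)\<^sup>2 = (\<Sum>i\<in>I. (f i \<bullet> w)\<^sup>2)"
    using assms by (rule norm_sum_orthonormal)
  moreover have "(norm (w - ?p))\<^sup>2 = (norm w)\<^sup>2 - 2 * (w \<bullet> ?p) + (norm ?p)\<^sup>2"
    by (simp add: power2_norm_eq_inner inner_diff inner_commute)
  ultimately show ?thesis
    using zero_le_power2[of "norm (w - ?p)"] by linarith
qed

text \<open>The left-hand side is the squared distance from \<open>y\<close> to the span. If
  \<open>w\<close> has coefficients \<open>a b\<close>, the right-hand side exceeds it by the sum of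
  the squares of \<open>y \<bullet> b - a b\<close>.\<close>

lemma dist_span_orthonormal_ge:
  fixes y w :: "'a::real_inner"
  assumes "finite B"
    and "\<And>b c. b \<in> B \<Longrightarrow> c \<in> B \<Longrightarrow> b \<bullet> c = (if b = c then 1 else 0)"
    and "w \<in> span B"
  shows "(norm y)\<^sup>2 - (\<Sum>b\<in>B. (y \<bullet> b)\<^sup>2) \<le> (norm (y - w))\<^sup>2"
proof -
  obtain a where w: "w = (\<Sum>b\<in>B. a b *\<^sub>R b)"
    using assms(1,3) by (auto simp: span_finite)
  have "(norm w)\<^sup>2 = (\<Sum>b\<in>B. (a b)\<^sup>2)"
    unfolding w using norm_sum_orthonormal[of B "\<lambda>b. b"] assms(1,2) by auto
  moreover have "y \<bullet> w = (\<Sum>b\<in>B. a b * (y \<bullet> b))"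
    by (simp add: w inner_sum_right)
  moreover have "(norm (y - w))\<^sup>2 = (norm y)\<^sup>2 - 2 * (y \<bullet> w) + (norm w)\<^sup>2"
    by (simp add: power2_norm_eq_inner inner_diff inner_commute)
  moreover have "0 \<le> (\<Sum>b\<in>B. (y \<bullet> b - a b)\<^sup>2)"
    by (intro sum_nonneg) simp
  moreover have "(\<Sum>b\<in>B. (y \<bullet> b - a b)\<^sup>2)
      = (\<Sum>b\<in>B. (y \<bullet> b)\<^sup>2) - 2 * (\<Sum>b\<in>B. a b * (y \<bullet> b)) + (\<Sum>b\<in>B. (a b)\<^sup>2)"
    by (simp add: power2_diff sum.distrib sum_subtractf sum_distrib_left algebra_simps)
  ultimately show ?thesis by linarith
qed

section \<open>Rank\<close>

lemma span_rows_eq: "span (rows (X :: real^'n^'m)) = span (range (($) X))"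
proof -
  have "rows X = range (($) X)"
    by (auto simp: rows_def row_def vec_nth_inverse)
  then show ?thesis by simp
qed

lemma rank_le_card:
  fixes X :: "real^'n^'m"
  assumes "finite B" "\<And>i. X $ i \<in> span B"
  shows "rank X \<le> card B"
proof -
  have "rows X \<subseteq> span B"
    using assms(2) by (auto simp: rows_def row_def vec_nth_inverse)
  then show ?thesis
    unfolding row_rank_def using assms(1) by (rule dim_le_card)
qed

text \<open>\<open>B\<close> is an orthonormal basis of the row space. Its cardinality reduces rank
  inequalities to counting spanning vectors via \<open>rank_le_card\<close>; its orthonormality
  serves the projection in \<open>eckart_young_frobenius\<close>.\<close>

lemma rank_orthonormal_basis:
  fixes X :: "real^'n^'m"
  obtains B where "finite B" "card B = rank X"
    and "\<And>b c. b \<in> B \<Longrightarrow> c \<in> B \<Longrightarrow> b \<bullet> c = (if b = c then 1 else 0)"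
    and "\<And>i. X $ i \<in> span B"
proof -
  obtain B where B: "pairwise orthogonal B" "\<And>x. x \<in> B \<Longrightarrow> norm x = 1"
    "independent B" "card B = dim (span (rows X))" "span B = span (rows X)"
    using orthonormal_basis_subspace[OF subspace_span, of "rows X"] by metis
  show thesis
  proof
    show "finite B"
      using B(3) independent_imp_finite by blast
    show "card B = rank X"
      using B(4) by (simp add: row_rank_def)
    show "b \<bullet> c = (if b = c then 1 else 0)" if "b \<in> B" "c \<in> B" for b c
      using that B(1,2) by (auto simp: pairwise_def orthogonal_def norm_eq_1)
    show "X $ i \<in> span B" for i
      unfolding B(5) span_rows_eq by (intro span_base) simp
  qed
qed

lemma rank_add_le:
  fixes X Y :: "real^'n^'m"
  shows "rank (X + Y) \<le> rank X + rank Y"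
proof -
  obtain B where B: "finite B" "card B = rank X" "\<And>i. X $ i \<in> span B"
    using rank_orthonormal_basis by metis
  obtain C where C: "finite C" "card C = rank Y" "\<And>i. Y $ i \<in> span C"
    using rank_orthonormal_basis by metis
  have "(X + Y) $ i \<in> span (B \<union> C)" for i
    unfolding vector_add_component
    using B(3)[of i] C(3)[of i] span_mono[of B "B \<union> C"] span_mono[of C "B \<union> C"]
    by (intro span_add) auto
  then have "rank (X + Y) \<le> card (B \<union> C)"
    using B(1) C(1) by (intro rank_le_card) auto
  also have "\<dots> \<le> rank X + rank Y"
    using card_Un_le[of B C] B(2) C(2) by simp
  finally show ?thesis .
qed

lemma rank_scaleR_le:
  fixes X :: "real^'n^'m"
  shows "rank (c *\<^sub>R X) \<le> rank X"
proof -
  obtain B where B: "finite B" "card B = rank X" "\<And>i. X $ i \<in> span B"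
    using rank_orthonormal_basis by metis
  then show ?thesis
    using rank_le_card[OF B(1), of "c *\<^sub>R X"] by (simp add: span_scale)
qed

section \<open>Singular value decompositions\<close>

lemma outer_component: "outer u v $ i = (u $ i) *\<^sub>R v"
  by (simp add: outer_def vec_eq_iff matrix_matrix_mult_def columnvector_def rowvector_def)

lemma inner_outer: "outer u v \<bullet> outer u' v' = (u \<bullet> u') * (v \<bullet> v')"
  unfolding inner_vec_def[of "outer u v"] inner_vec_def[of u u']
  by (simp add: outer_component sum_distrib_left mult_ac)

lemma matrix_vector_mult_outer: "outer u v *v w = (v \<bullet> w) *\<^sub>R u"
  by (simp add: vec_eq_iff matrix_vector_mult_def outer_component inner_vec_def
      sum_distrib_left sum_distrib_right mult_ac)

text \<open>Makes squared Frobenius norms of partial sums of the decomposition equal to sums of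
  squared singular values.\<close>

lemma is_svd_outer_orthonormal:
  fixes Y :: "real^'n^'m"
  assumes "is_svd \<sigma> u v Y" "i \<in> {1..CARD('m)}" "j \<in> {1..CARD('m)}"
  shows "outer (u i) (v i) \<bullet> outer (u j) (v j) = (if i = j then 1 else 0)"
  using assms by (simp add: is_svd_def inner_outer)

lemma rank_svd_truncation_le:
  "rank ((\<Sum>i=1..r. \<sigma> i *\<^sub>R outer (u i) (v i)) :: real^'n^'m) \<le> r"
proof -
  have "rank ((\<Sum>i=1..r. \<sigma> i *\<^sub>R outer (u i) (v i)) :: real^'n^'m) \<le> card (v ` {1..r})"
  proof (rule rank_le_card)
    show "(\<Sum>i=1..r. \<sigma> i *\<^sub>R outer (u i) (v i)) $ k \<in> span (v ` {1..r})" for k :: 'm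
      unfolding sum_component vector_scaleR_component outer_component
      by (intro span_sum span_scale span_base imageI)
  qed simp
  also have "\<dots> \<le> r"
    using card_image_le[of "{1..r}" v] by simp
  finally show ?thesis .
qed

lemma rank_hard_threshold_le: "is_hard_threshold r Y Z \<Longrightarrow> rank Z \<le> r"
  unfolding is_hard_threshold_def using rank_svd_truncation_le by auto

text \<open>Compare \<open>c\<close> with the indicator \<open>?d\<close> of the first
  \<open>r\<close> indices. Up to \<open>r\<close>, \<open>s i - s r\<close> is nonnegative and
  \<open>c i - ?d i\<close> nonpositive; beyond \<open>r\<close> both signs flip, so every product
  is nonpositive. The remaining multiple of \<open>s r\<close> is controlled by the total weight of
  \<open>c\<close>, which is at most \<open>r\<close>.\<close>

lemma weighted_sum_le_initial_sum:
  fixes s c :: "nat \<Rightarrow> real"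
  assumes "1 \<le> r" "r \<le> m"
    and "\<And>i j. 1 \<le> i \<Longrightarrow> i \<le> j \<Longrightarrow> j \<le> m \<Longrightarrow> s j \<le> s i"
    and "0 \<le> s r"
    and "\<And>i. i \<in> {1..m} \<Longrightarrow> 0 \<le> c i \<and> c i \<le> 1"
    and "(\<Sum>i=1..m. c i) \<le> r"
  shows "(\<Sum>i=1..m. s i * c i) \<le> (\<Sum>i=1..r. s i)"
proof -
  have sub: "{1..r} \<subseteq> {1..m}"
    using assms(2) by auto
  let ?d = "\<lambda>i. if i \<in> {1..r} then 1 else 0 :: real"
  have restrict: "(\<Sum>i=1..m. f i * ?d i) = (\<Sum>i=1..r. f i)" for f :: "nat \<Rightarrow> real"
  proof -
    have "(\<Sum>i=1..m. f i * ?d i) = (\<Sum>i=1..m. if i \<in> {1..r} then f i else 0)"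
      by (intro sum.cong) auto
    also have "\<dots> = sum f ({1..m} \<inter> {1..r})"
      by (rule sum.inter_restrict[symmetric]) simp
    finally show ?thesis
      using sub by (simp only: Int_absorb1)
  qed
  have "(s i - s r) * (c i - ?d i) \<le> 0" if "i \<in> {1..m}" for i
  proof (cases "i \<le> r")
    case True
    then show ?thesis
      using that assms(2) assms(3)[of i r] assms(5)[of i] by (auto intro: mult_nonneg_nonpos)
  next
    case False
    then show ?thesis
      using that assms(1) assms(3)[of r i] assms(5)[of i] by (auto intro: mult_nonpos_nonneg)
  qed
  then have "(\<Sum>i=1..m. (s i - s r) * (c i - ?d i)) \<le> 0"
    by (rule sum_nonpos)
  moreover have "(\<Sum>i=1..m. (s i - s r) * (c i - ?d i))
      = (\<Sum>i=1..m. s i * c i) - (\<Sum>i=1..m. s i * ?d i)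
        - s r * (\<Sum>i=1..m. c i) + s r * (\<Sum>i=1..m. 1 * ?d i)"
    by (simp only: sum_distrib_left sum_subtractf[symmetric] sum.distrib[symmetric])
       (intro sum.cong refl, simp add: algebra_simps)
  moreover have "s r * (\<Sum>i=1..m. c i) \<le> s r * r"
    using assms(4,6) by (intro mult_left_mono)
  ultimately show ?thesis
    unfolding restrict by simp
qed

text \<open>
  Projecting the rows of \<open>Y\<close> onto the row space of \<open>W\<close> bounds \<open>\<parallel>Y - W\<parallel>\<^sup>2\<close> from below by
  \<open>\<Sum> \<sigma>\<^sub>i\<^sup>2 (1 - c\<^sub>i)\<close>, where \<open>c\<^sub>i\<close> is the squared length of the projection of \<open>v\<^sub>i\<close>. Bessel's
  inequality yields \<open>c\<^sub>i \<le> 1\<close> and \<open>\<Sum> c\<^sub>i \<le> r\<close>, so the bound is least when \<open>c\<close> selects the first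
  \<open>r\<close> indices.
\<close>
lemma eckart_young_frobenius:
  fixes Y Z W :: "real^'n^'m"
  assumes "is_hard_threshold r Y Z" "1 \<le> r" "r \<le> CARD('m)" "rank W \<le> r"
  shows "norm (Y - Z) \<le> norm (Y - W)"
proof -
  let ?m = "CARD('m)"
  obtain \<sigma> u v where svd: "is_svd \<sigma> u v Y" and Z: "Z = (\<Sum>i=1..r. \<sigma> i *\<^sub>R outer (u i) (v i))"
    using assms(1) unfolding is_hard_threshold_def by blast
  let ?E = "\<lambda>i. outer (u i) (v i) :: real^'n^'m"
  have pos: "\<And>i. i \<in> {1..?m} \<Longrightarrow> 0 \<le> \<sigma> i"
    and decr: "\<And>i j. 1 \<le> i \<Longrightarrow> i \<le> j \<Longrightarrow> j \<le> ?m \<Longrightarrow> \<sigma> j \<le> \<sigma> i"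
    and u: "\<And>i j. i \<in> {1..?m} \<Longrightarrow> j \<in> {1..?m} \<Longrightarrow> u i \<bullet> u j = (if i = j then 1 else 0)"
    and v: "\<And>i j. i \<in> {1..?m} \<Longrightarrow> j \<in> {1..?m} \<Longrightarrow> v i \<bullet> v j = (if i = j then 1 else 0)"
    and Y: "Y = (\<Sum>i=1..?m. \<sigma> i *\<^sub>R ?E i)"
    using svd unfolding is_svd_def by auto
  have split: "{1..?m} = {1..r} \<union> {r<..?m}" "{1..r} \<inter> {r<..?m} = {}"
    using assms(3) by auto
  have normY: "(norm Y)\<^sup>2 = (\<Sum>i=1..?m. (\<sigma> i)\<^sup>2)"
    unfolding Y using is_svd_outer_orthonormal[OF svd] by (intro norm_sum_orthonormal) auto
  have "Y - Z = (\<Sum>i\<in>{r<..?m}. \<sigma> i *\<^sub>R ?E i)"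
    unfolding Y Z split(1) using split(2) by (subst sum.union_disjoint) auto
  then have normYZ: "(norm (Y - Z))\<^sup>2 = (\<Sum>i\<in>{r<..?m}. (\<sigma> i)\<^sup>2)"
    using is_svd_outer_orthonormal[OF svd] by (auto intro!: norm_sum_orthonormal)

  obtain B where B: "finite B" "card B = rank W"
    "\<And>b c. b \<in> B \<Longrightarrow> c \<in> B \<Longrightarrow> b \<bullet> c = (if b = c then 1 else 0)"
    "\<And>i. W $ i \<in> span B"
    using rank_orthonormal_basis[of W] by blast
  define c where "c i = (\<Sum>b\<in>B. (v i \<bullet> b)\<^sup>2)" for i
  \<comment> \<open>The left-hand side is the squared norm of \<open>Y *v b\<close>, whose
    coordinates in the orthonormal family \<open>u\<close> are read off the decomposition.\<close>
  have Yb: "(\<Sum>k\<in>UNIV. (Y $ k \<bullet> b)\<^sup>2) = (\<Sum>i=1..?m. (\<sigma> i)\<^sup>2 * (v i \<bullet> b)\<^sup>2)" for b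
  proof -
    have "(\<Sum>k\<in>UNIV. (Y $ k \<bullet> b)\<^sup>2) = (norm (Y *v b))\<^sup>2"
      unfolding power2_norm_eq_inner inner_vec_def[of "Y *v b"]
      by (simp add: matrix_vector_mul_component power2_eq_square)
    also have "Y *v b = (\<Sum>i=1..?m. (\<sigma> i * (v i \<bullet> b)) *\<^sub>R u i)"
    proof -
      have "linear (\<lambda>M :: real^'n^'m. M *v b)"
        by (intro linearI) (simp_all add: matrix_vector_mult_add_rdistrib scaleR_matrix_vector_assoc)
      then show ?thesis
        unfolding Y
        by (simp add: linear_sum[where f = "\<lambda>M. M *v b"]
            scaleR_matrix_vector_assoc[symmetric] matrix_vector_mult_outer)
    qed
    also have "(norm \<dots>)\<^sup>2 = (\<Sum>i=1..?m. (\<sigma> i * (v i \<bullet> b))\<^sup>2)"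
      using u by (intro norm_sum_orthonormal) auto
    finally show ?thesis
      by (simp add: power_mult_distrib)
  qed
  \<comment> \<open>The distance bound is applied to each row separately; exchanging the sums over
    rows, basis vectors and singular indices then produces the weights \<open>c i\<close>.\<close>
  have normYW: "(norm Y)\<^sup>2 - (\<Sum>i=1..?m. (\<sigma> i)\<^sup>2 * c i) \<le> (norm (Y - W))\<^sup>2"
  proof -
    have rows: "(norm M)\<^sup>2 = (\<Sum>k\<in>UNIV. (norm (M $ k))\<^sup>2)" for M :: "real^'n^'m"
      by (simp add: power2_norm_eq_inner inner_vec_def)
    have "(\<Sum>k\<in>UNIV. \<Sum>b\<in>B. (Y $ k \<bullet> b)\<^sup>2) = (\<Sum>b\<in>B. \<Sum>i=1..?m. (\<sigma> i)\<^sup>2 * (v i \<bullet> b)\<^sup>2)"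
      by (subst sum.swap) (simp add: Yb)
    also have "\<dots> = (\<Sum>i=1..?m. (\<sigma> i)\<^sup>2 * c i)"
      by (subst sum.swap) (simp add: c_def sum_distrib_left)
    finally have "(norm Y)\<^sup>2 - (\<Sum>i=1..?m. (\<sigma> i)\<^sup>2 * c i)
        = (\<Sum>k\<in>UNIV. (norm (Y $ k))\<^sup>2 - (\<Sum>b\<in>B. (Y $ k \<bullet> b)\<^sup>2))"
      by (simp add: rows[of Y] sum_subtractf)
    also have "\<dots> \<le> (\<Sum>k\<in>UNIV. (norm (Y $ k - W $ k))\<^sup>2)"
      using B by (intro sum_mono dist_span_orthonormal_ge) auto
    finally show ?thesis
      by (simp add: rows[of "Y - W"])
  qed
  have "(\<Sum>i=1..?m. (\<sigma> i)\<^sup>2 * c i) \<le> (\<Sum>i=1..r. (\<sigma> i)\<^sup>2)"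
  proof (rule weighted_sum_le_initial_sum)
    show "(\<sigma> j)\<^sup>2 \<le> (\<sigma> i)\<^sup>2" if "1 \<le> i" "i \<le> j" "j \<le> ?m" for i j
      using that decr[OF that] pos[of j] by (intro power_mono) auto
    show "0 \<le> c i \<and> c i \<le> 1" if "i \<in> {1..?m}" for i
    proof
      show "0 \<le> c i"
        unfolding c_def by (intro sum_nonneg) simp
      have "(\<Sum>b\<in>B. (b \<bullet> v i)\<^sup>2) \<le> (norm (v i))\<^sup>2"
        using B by (intro bessel_inequality) auto
      then show "c i \<le> 1"
        using v[OF that that] by (simp add: c_def inner_commute power2_norm_eq_inner)
    qed
    \<comment> \<open>Bessel's inequality with the roles exchanged: here the \<open>v i\<close> are
      the orthonormal family and each unit vector \<open>b\<close> is expanded, so every element of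
      \<open>B\<close> contributes at most 1.\<close>
    have "(\<Sum>i=1..?m. c i) = (\<Sum>b\<in>B. \<Sum>i=1..?m. (v i \<bullet> b)\<^sup>2)"
      unfolding c_def by (rule sum.swap)
    also have "\<dots> \<le> (\<Sum>b\<in>B. 1)"
    proof (rule sum_mono)
      fix b assume "b \<in> B"
      then have "(norm b)\<^sup>2 = 1"
        using B(3)[of b b] by (simp add: power2_norm_eq_inner)
      moreover have "(\<Sum>i=1..?m. (v i \<bullet> b)\<^sup>2) \<le> (norm b)\<^sup>2"
        using v by (intro bessel_inequality) auto
      ultimately show "(\<Sum>i=1..?m. (v i \<bullet> b)\<^sup>2) \<le> 1" by simp
    qed
    also have "\<dots> \<le> r"
      using B(2) assms(4) by simp
    finally show "(\<Sum>i=1..?m. c i) \<le> r" .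
  qed (use assms in auto)
  moreover have "(norm Y)\<^sup>2 = (\<Sum>i=1..r. (\<sigma> i)\<^sup>2) + (norm (Y - Z))\<^sup>2"
    unfolding normY normYZ split(1) using split(2) by (intro sum.union_disjoint) auto
  ultimately have "(norm (Y - Z))\<^sup>2 \<le> (norm (Y - W))\<^sup>2"
    using normYW by linarith
  then show ?thesis
    by (rule power2_le_imp_le) simp
qed

section \<open>Restricted isometry property and the iteration\<close>

lemma rip_bound_mono:
  fixes A :: "real^'n^'m \<Rightarrow> real^'p"
  shows "rip_bound A s d \<Longrightarrow> d \<le> d' \<Longrightarrow> rip_bound A s d'"
  unfolding rip_bound_def
proof (intro allI impI)
  fix X :: "real^'n^'m"
  assume *: "\<forall>X. rank X \<le> s \<longrightarrow>
      (1 - d) * (norm X)\<^sup>2 \<le> (norm (A X))\<^sup>2 \<and> (norm (A X))\<^sup>2 \<le> (1 + d) * (norm X)\<^sup>2"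
    and "d \<le> d'" "rank X \<le> s"
  then have "(1 - d') * (norm X)\<^sup>2 \<le> (1 - d) * (norm X)\<^sup>2"
    and "(1 + d) * (norm X)\<^sup>2 \<le> (1 + d') * (norm X)\<^sup>2"
    by (auto intro: mult_right_mono)
  with *[rule_format, OF \<open>rank X \<le> s\<close>]
  show "(1 - d') * (norm X)\<^sup>2 \<le> (norm (A X))\<^sup>2 \<and> (norm (A X))\<^sup>2 \<le> (1 + d') * (norm X)\<^sup>2"
    by linarith
qed

text \<open>Polarization: the lower bound is used on the sum of the rescaled matrices and the upper
  bound on their difference. In the combination the terms \<open>d * (D \<bullet> H)\<close> cancel,
  leaving only the product of the norms as error.\<close>

lemma rip_bound_inner:
  fixes A :: "real^'n^'m \<Rightarrow> real^'p"
  assumes "linear A" "rip_bound A s d"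
    and "\<And>x y. rank (x *\<^sub>R D + y *\<^sub>R H) \<le> s"
  shows "D \<bullet> H - A D \<bullet> A H \<le> d * norm D * norm H"
proof (cases "D = 0 \<or> H = 0")
  case True
  then show ?thesis
    using linear_0[OF assms(1)] by auto
next
  case False
  \<comment> \<open>The crossed weights give \<open>p *\<^sub>R D\<close> and
    \<open>q *\<^sub>R H\<close> the same norm \<open>p * q\<close>, so that dividing by
    \<open>p * q\<close> leaves exactly \<open>d * norm D * norm H\<close>.\<close>
  define p q where "p = norm H" and "q = norm D"
  have pq: "0 < p * q"
    using False by (simp add: p_def q_def)
  let ?S = "p *\<^sub>R D + q *\<^sub>R H" and ?T = "p *\<^sub>R D + (- q) *\<^sub>R H"
  have "(1 - d) * (norm ?S)\<^sup>2 \<le> (norm (A ?S))\<^sup>2" "(norm (A ?T))\<^sup>2 \<le> (1 + d) * (norm ?T)\<^sup>2"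
    using assms(2,3) unfolding rip_bound_def by blast+
  moreover have expand: "(norm (p *\<^sub>R D + t *\<^sub>R H))\<^sup>2
      = p\<^sup>2 * q\<^sup>2 + 2 * (p * t) * (D \<bullet> H) + t\<^sup>2 * p\<^sup>2" for t
    unfolding power2_norm_eq_inner inner_add_left inner_add_right inner_scaleR_left inner_scaleR_right
    by (simp add: inner_commute[of H D] dot_square_norm p_def q_def power2_eq_square algebra_simps)
  moreover have "(norm (A ?S))\<^sup>2 - (norm (A ?T))\<^sup>2 = 4 * (p * q) * (A D \<bullet> A H)"
    unfolding power2_norm_eq_inner linear_add[OF assms(1)] linear_scale[OF assms(1)]
    by (simp add: inner_add inner_commute[of "A H" "A D"] algebra_simps)
  ultimately have "(1 - d) * (p\<^sup>2 * q\<^sup>2 + 2 * (p * q) * (D \<bullet> H) + q\<^sup>2 * p\<^sup>2)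
      - (1 + d) * (p\<^sup>2 * q\<^sup>2 + 2 * (p * (- q)) * (D \<bullet> H) + (- q)\<^sup>2 * p\<^sup>2)
      \<le> 4 * (p * q) * (A D \<bullet> A H)"
    unfolding expand by linarith
  then have "(p * q) * (D \<bullet> H - A D \<bullet> A H) \<le> (p * q) * (d * (p * q))"
    by (simp add: algebra_simps power2_eq_square)
  then have "D \<bullet> H - A D \<bullet> A H \<le> d * (p * q)"
    using pq by (simp only: mult_le_cancel_left_pos)
  then show ?thesis
    by (simp add: p_def q_def mult_ac)
qed

lemma iht_step:
  fixes A :: "real^'n^'m \<Rightarrow> real^'p" and W X Z :: "real^'n^'m"
  assumes "linear A" "rip_bound A (3 * r) d" "1 \<le> r" "r \<le> CARD('m)"
    and "rank W \<le> r" "rank X \<le> r"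
    and "is_hard_threshold r (X - adjoint A (A X - (A W + e))) Z"
  shows "norm (W - Z) \<le> 2 * d * norm (W - X) + 2 * sqrt (1 + d) * norm e"
proof -
  let ?Y = "X - adjoint A (A X - (A W + e))"
  define D H where "D = W - Z" and "H = W - X"
  have rankZ: "rank Z \<le> r"
    using assms(7) by (rule rank_hard_threshold_le)
  have rank: "rank (x *\<^sub>R D + y *\<^sub>R H) \<le> 3 * r" for x y
  proof -
    \<comment> \<open>\<open>D\<close> and \<open>H\<close> share \<open>W\<close>, so only three
      matrices of rank at most \<open>r\<close> are involved, whence \<open>3 * r\<close>.\<close>
    have "x *\<^sub>R D + y *\<^sub>R H = (x + y) *\<^sub>R W + ((- x) *\<^sub>R Z + (- y) *\<^sub>R X)"
      by (simp add: D_def H_def algebra_simps)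
    then show ?thesis
      using rank_add_le[of "(x + y) *\<^sub>R W" "(- x) *\<^sub>R Z + (- y) *\<^sub>R X"]
        rank_add_le[of "(- x) *\<^sub>R Z" "(- y) *\<^sub>R X"]
        rank_scaleR_le[of "x + y" W] rank_scaleR_le[of "- x" Z] rank_scaleR_le[of "- y" X]
        assms(5,6) rankZ by simp
  qed
  have "(norm (?Y - Z))\<^sup>2 \<le> (norm (?Y - W))\<^sup>2"
    using eckart_young_frobenius[OF assms(7,3,4,5)] by (intro power_mono) auto
  moreover have "?Y - Z = (?Y - W) + D"
    by (simp add: D_def)
  moreover have "(norm ((?Y - W) + D))\<^sup>2 = (norm (?Y - W))\<^sup>2 + 2 * (D \<bullet> (?Y - W)) + (norm D)\<^sup>2"
    by (simp add: power2_norm_eq_inner inner_add inner_commute)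
  ultimately have "(norm D)\<^sup>2 \<le> - 2 * (D \<bullet> (?Y - W))"
    by simp
  also have "D \<bullet> (?Y - W) = - (D \<bullet> H) - A D \<bullet> (A X - (A W + e))"
    by (simp add: H_def inner_diff_right adjoint_works[OF assms(1)])
  also have "\<dots> = - (D \<bullet> H - A D \<bullet> A H) + A D \<bullet> e"
    by (simp add: H_def linear_diff[OF assms(1)] inner_diff_right inner_add_right)
  finally have "(norm D)\<^sup>2 \<le> 2 * (D \<bullet> H - A D \<bullet> A H) + 2 * (- (A D \<bullet> e))"
    by simp
  also have "\<dots> \<le> 2 * (d * norm D * norm H) + 2 * (sqrt (1 + d) * norm D * norm e)"
  proof (intro add_mono mult_left_mono)
    show "D \<bullet> H - A D \<bullet> A H \<le> d * norm D * norm H"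
      using rip_bound_inner[OF assms(1,2) rank] .
    have "(norm (A D))\<^sup>2 \<le> (1 + d) * (norm D)\<^sup>2"
      using assms(2) rank[of 1 0] by (simp add: rip_bound_def)
    then have "norm (A D) \<le> sqrt (1 + d) * norm D"
      using real_le_rsqrt by (fastforce simp: real_sqrt_mult)
    then have "norm (A D) * norm e \<le> sqrt (1 + d) * norm D * norm e"
      by (simp add: mult_right_mono)
    then show "- (A D \<bullet> e) \<le> sqrt (1 + d) * norm D * norm e"
      using Cauchy_Schwarz_ineq2[of "A D" e] by linarith
  qed auto
  \<comment> \<open>Cancelling \<open>norm D\<close> gives the claim unless
    \<open>D = 0\<close>.\<close>
  finally have *: "norm D * norm D \<le> norm D * (2 * d * norm H + 2 * sqrt (1 + d) * norm e)"
    by (simp add: power2_eq_square algebra_simps)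
  show ?thesis
  proof (cases "D = 0")
    case False
    then show ?thesis
      using * by (simp add: D_def H_def)
  next
    case True
    \<comment> \<open>For \<open>D = 0\<close> the right-hand side has to be shown nonnegative. The
      two isometry bounds at one nonzero matrix of rank at most 1 force \<open>d\<close> to be
      nonnegative.\<close>
    have "0 \<le> d"
    proof -
      obtain M :: "real^'n^'m" where M: "M \<noteq> 0" "rank M \<le> 1"
        using ex_rank_1_matrix by blast
      then have "rank M \<le> 3 * r"
        using assms(3) by linarith
      then have "(1 - d) * (norm M)\<^sup>2 \<le> (1 + d) * (norm M)\<^sup>2"
        using assms(2) unfolding rip_bound_def by (meson order_trans)
      then have "1 - d \<le> 1 + d"
        using M(1) by (simp add: mult_le_cancel_right)
      then show ?thesis by simp
    qed
    then show ?thesis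
      using True by (simp add: D_def)
  qed
qed

text \<open>The constant \<open>c / (1 - a)\<close> is the fixed point of the map sending
  \<open>t\<close> to \<open>a * t + c\<close>, so it reproduces itself in the induction
  step.\<close>

lemma affine_recurrence_bound:
  fixes x :: "nat \<Rightarrow> real"
  assumes "0 \<le> a" "a < 1" "0 \<le> c" "\<And>k. x (Suc k) \<le> a * x k + c"
  shows "x k \<le> a ^ k * x 0 + c / (1 - a)"
proof (induction k)
  case 0
  then show ?case
    using assms(2,3) by simp
next
  case (Suc k)
  have "x (Suc k) \<le> a * (a ^ k * x 0 + c / (1 - a)) + c"
    using assms(4)[of k] mult_left_mono[OF Suc assms(1)] by linarith
  also have "\<dots> = a ^ Suc k * x 0 + c / (1 - a)"
    using assms(2) by (simp add: field_simps)
  finally show ?case .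
qed

lemma power_nat_ceiling_log_le:
  fixes a x y :: real
  assumes "0 < a" "a < 1" "0 \<le> x" "0 < y"
  shows "a ^ nat \<lceil>log (1 / a) (x / y)\<rceil> * x \<le> y"
proof (cases "x = 0")
  \<comment> \<open>Treated apart because the logarithm law used below requires a positive
    argument.\<close>
  case True
  then show ?thesis
    using assms(4) by simp
next
  case False
  let ?k = "nat \<lceil>log (1 / a) (x / y)\<rceil>"
  \<comment> \<open>This also covers \<open>x < y\<close>: the logarithm is then negative and
    \<open>nat\<close> never yields a value below the ceiling.\<close>
  have "log (1 / a) (x / y) \<le> real ?k"
    by linarith
  then have "x / y \<le> (1 / a) powr ?k"
    using assms False by (simp add: log_le_iff)
  also have "\<dots> = 1 / a ^ ?k"
    using assms(1) by (simp add: powr_realpow power_divide)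
  finally show ?thesis
    using assms by (simp add: field_simps)
qed

theorem theorem4p2:
  fixes A :: "real^'n^'m \<Rightarrow> real^'p"
    and b e :: "real^'p"
    and Xr X0 :: "real^'n^'m"
    and X :: "nat \<Rightarrow> real^'n^'m"
    and r :: nat
    and \<alpha> \<beta> :: real
  assumes "CARD('m) \<le> CARD('n)"
    and "linear A"
    and "1 \<le> r" and "3 * r \<le> CARD('m)"
    and "rank Xr = r"
    and "b = A Xr + e"
    and "0 < \<alpha>" and "\<alpha> < 1"
    and "rip_const A (3 * r) \<le> \<alpha> / sqrt 8"
    and "rank X0 \<le> r"
    and "iht_iterates A b r X0 X"
    and "\<beta> = 2 * sqrt (1 + \<alpha> / sqrt 8)"
  shows "(\<forall>k. norm (Xr - X k) \<le> \<alpha> ^ k * norm (Xr - X0) + \<beta> / (1 - \<alpha>) * norm e) \<and>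
    (e \<noteq> 0 \<longrightarrow>
      norm (Xr - X (nat \<lceil>log (1 / \<alpha>) (norm (Xr - X0) / norm e)\<rceil>))
        \<le> (1 - \<alpha> + \<beta>) / (1 - \<alpha>) * norm e)"
proof -
  let ?d = "\<alpha> / sqrt 8"
  have rip: "rip_bound A (3 * r) ?d"
    using rip_bound_rip_const(1)[of A "3 * r"] rip_bound_mono assms(2,3,9) by fastforce
  have threshold: "is_hard_threshold r (X k - adjoint A (A (X k) - (A Xr + e))) (X (Suc k))" for k
    using assms(6,11) by (simp add: iht_iterates_def)
  have X0: "X 0 = X0"
    using assms(11) by (simp add: iht_iterates_def)
  \<comment> \<open>Thresholding bounds the rank of all later iterates, the hypothesis on
    \<open>X0\<close> that of the first. This keeps \<open>Xr - X k\<close> within the reach of the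
    isometry bound at \<open>3 * r\<close>.\<close>
  have rank: "rank (X k) \<le> r" for k
  proof (cases k)
    case 0
    then show ?thesis
      using X0 assms(10) by simp
  next
    case (Suc l)
    then show ?thesis
      using rank_hard_threshold_le[OF threshold[of l]] by simp
  qed
  have "2 \<le> sqrt 8"
    by (rule real_le_rsqrt) simp
  then have d: "2 * ?d \<le> \<alpha>"
    using assms(7) by (simp add: field_simps)
  have step: "norm (Xr - X (Suc k)) \<le> \<alpha> * norm (Xr - X k) + \<beta> * norm e" for k
  proof -
    have "norm (Xr - X (Suc k)) \<le> 2 * ?d * norm (Xr - X k) + 2 * sqrt (1 + ?d) * norm e"
      using assms(3-5) by (intro iht_step[OF assms(2) rip _ _ _ rank threshold]) auto
    also have "2 * ?d * norm (Xr - X k) \<le> \<alpha> * norm (Xr - X k)"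
      using d by (rule mult_right_mono) simp
    finally show ?thesis
      by (simp add: assms(12))
  qed
  have "0 \<le> \<beta> * norm e"
    using assms(7,12) by simp
  then have bound: "norm (Xr - X k) \<le> \<alpha> ^ k * norm (Xr - X0) + \<beta> / (1 - \<alpha>) * norm e" for k
    using affine_recurrence_bound[where x = "\<lambda>k. norm (Xr - X k)", OF _ assms(8) _ step] assms(7) X0
    by simp
  have "norm (Xr - X (nat \<lceil>log (1 / \<alpha>) (norm (Xr - X0) / norm e)\<rceil>))
        \<le> (1 - \<alpha> + \<beta>) / (1 - \<alpha>) * norm e" (is "norm (Xr - X ?k) \<le> _") if "e \<noteq> 0"
  proof -
    have "\<alpha> ^ ?k * norm (Xr - X0) \<le> norm e"
      using assms(7,8) that by (intro power_nat_ceiling_log_le) auto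
    then have "norm (Xr - X ?k) \<le> norm e + \<beta> / (1 - \<alpha>) * norm e"
      using bound[of ?k] by linarith
    also have "\<dots> = (1 - \<alpha> + \<beta>) / (1 - \<alpha>) * norm e"
      using assms(8) by (simp add: field_simps)
    finally show ?thesis .
  qed
  with bound show ?thesis by blast
qed

end
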